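(* Let $m\ge 1$ and let $\{P_i\}_{i=1}^n$ be a finite family of orthogonal projections on $\mathbb{R}^m$. Then $\{P_i\}_{i=1}^n$ does phase retrieval if and only if it does phaseless reconstruction.
   Context: $\mathbb{R}^m$ carries the standard inner product and norm; vectors are written in coordinates, $x=(a_1,\dots,a_m)$. Same phases (real case): $x=(a_1,\dots,a_m)$ and $y=(b_1,\dots,b_m)$ have the same phases if $a_i$ and $b_i$ have the same phase for every $i=1,\dots,m$. Zero has no phase, so this means that for every $i$ either $a_i=b_i=0$, or $a_i\neq 0\neq b_i$ and $a_i/|a_i|=b_i/|b_i|$. Phase retrieval: $\{P_i\}_{i=1}^n$ does phase retrieval if for all $x,y\in\mathbb{R}^m$ with $\|P_ix\|=\|P_iy\|$ for all $i=1,\dots,n$, there is $\theta\in\{1,-1\}$ such that $x$ and $\theta y$ have the same phases. Phaseless reconstruction: $\{P_i\}_{i=1}^n$ does phaseless reconstruction if for all $x,y\in\mathbb{R}^m$ with $\|P_ix\|=\|P_iy\|$ for all $i=1,\dots,n$, there is $\theta\in\{1,-1\}$ such that $x=\theta y$. *)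

theory Defs
  imports "HOL-Analysis.Analysis"
begin

definition orthogonal_projection :: "(real ^ 'm \<Rightarrow> real ^ 'm) \<Rightarrow> bool" where
  "orthogonal_projection P \<longleftrightarrow> linear P \<and> P \<circ> P = P \<and> adjoint P = P"

(* Zero has no phase, so it agrees in phase only with itself. *)
definition same_phase :: "real \<Rightarrow> real \<Rightarrow> bool" where
  "same_phase a b \<longleftrightarrow> (a = 0 \<and> b = 0) \<or> (a \<noteq> 0 \<and> b \<noteq> 0 \<and> a / \<bar>a\<bar> = b / \<bar>b\<bar>)"

definition same_phases :: "real ^ 'm \<Rightarrow> real ^ 'm \<Rightarrow> bool" where
  "same_phases x y \<longleftrightarrow> (\<forall>i. same_phase (x $ i) (y $ i))"

(* The family is P 1, ..., P n; values of P at other indices play no role. *)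
definition does_phase_retrieval :: "nat \<Rightarrow> (nat \<Rightarrow> real ^ 'm \<Rightarrow> real ^ 'm) \<Rightarrow> bool" where
  "does_phase_retrieval n P \<longleftrightarrow>
     (\<forall>x y. (\<forall>i\<in>{1..n}. norm (P i x) = norm (P i y)) \<longrightarrow>
        (\<exists>\<theta>\<in>{1, -1 :: real}. same_phases x (\<theta> *\<^sub>R y)))"

definition does_phaseless_reconstruction :: "nat \<Rightarrow> (nat \<Rightarrow> real ^ 'm \<Rightarrow> real ^ 'm) \<Rightarrow> bool" where
  "does_phaseless_reconstruction n P \<longleftrightarrow>
     (\<forall>x y. (\<forall>i\<in>{1..n}. norm (P i x) = norm (P i y)) \<longrightarrow>
        (\<exists>\<theta>\<in>{1, -1 :: real}. x = \<theta> *\<^sub>R y))"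

end

theory Submission
  imports Defs
begin

(* If x and y have equal measurements, then u = x + y and v = x - y satisfy P i u \<bullet> P i v = 0,
   so s u + t v and s u - t v have equal measurements for all real s and t.  Phase retrieval then
   forces u and v to have disjoint supports (otherwise take s = v_k, t = u_k to annihilate
   exactly one of the two k-th coordinates) and, with s = t = 1, forbids that both are non-zero. *)

lemma norm_add_eq_norm_diff_iff:
  fixes a b :: "'a::real_inner"
  shows "norm (a + b) = norm (a - b) \<longleftrightarrow> a \<bullet> b = 0"
  by (auto simp: norm_eq inner_add inner_diff inner_commute)

text \<open>By linearity the inner product of P (x + y) and P (x - y) is |P x|^2 - |P y|^2 = 0.
  Orthogonality survives scaling by s and t and turns back into equality of norms.\<close>

lemma norm_linear_eq_combination:
  fixes P :: "'a::real_vector \<Rightarrow> 'b::real_inner"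
  assumes "linear P" and "norm (P x) = norm (P y)"
  shows "norm (P (s *\<^sub>R (x + y) + t *\<^sub>R (x - y))) = norm (P (s *\<^sub>R (x + y) - t *\<^sub>R (x - y)))"
proof -
  interpret linear P by fact
  have "P (x + y) \<bullet> P (x - y) = 0"
    using assms(2) by (simp add: add diff norm_eq inner_add inner_diff inner_commute)
  then have "(s *\<^sub>R P (x + y)) \<bullet> (t *\<^sub>R P (x - y)) = 0"
    by simp
  then show ?thesis
    by (simp only: add diff scale flip: norm_add_eq_norm_diff_iff)
qed

lemma same_phases_refl: "same_phases x x"
  by (simp add: same_phases_def same_phase_def)

text \<open>Since \<open>sgn 0 = 0\<close>, the case of two zeros needs no separate treatment, and
  phase conditions become equations.\<close>

lemma same_phase_iff_sgn: "same_phase a b \<longleftrightarrow> sgn a = sgn b"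
  by (auto simp: same_phase_def sgn_if abs_if divide_simps)

lemma phase_retrieval_imp_phaseless_reconstruction:
  fixes P :: "nat \<Rightarrow> real ^ 'm \<Rightarrow> real ^ 'm"
  assumes lin: "\<And>i. i \<in> {1..n} \<Longrightarrow> linear (P i)"
    and retr: "does_phase_retrieval n P"
  shows "does_phaseless_reconstruction n P"
  unfolding does_phaseless_reconstruction_def
proof (intro allI impI)
  fix x y assume eq: "\<forall>i\<in>{1..n}. norm (P i x) = norm (P i y)"
  define u v where "u = x + y" and "v = x - y"
  have phases: "\<exists>\<theta>\<in>{1, -1}. \<forall>k. sgn (s * u $ k + t * v $ k) = sgn (\<theta> * (s * u $ k - t * v $ k))"
    for s t
  proof -
    have "\<forall>i\<in>{1..n}. norm (P i (s *\<^sub>R u + t *\<^sub>R v)) = norm (P i (s *\<^sub>R u - t *\<^sub>R v))"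
      unfolding u_def v_def using lin eq norm_linear_eq_combination by blast
    then have "\<exists>\<theta>\<in>{1, -1}. same_phases (s *\<^sub>R u + t *\<^sub>R v) (\<theta> *\<^sub>R (s *\<^sub>R u - t *\<^sub>R v))"
      using retr unfolding does_phase_retrieval_def by blast
    then show ?thesis
      by (simp only: same_phases_def same_phase_iff_sgn vector_add_component
          vector_minus_component vector_scaleR_component real_scaleR_def)
  qed
  have disjoint: "u $ k = 0 \<or> v $ k = 0" for k
  proof -
    \<comment> \<open>The right-hand argument is 0 whichever sign \<theta> is, so 2 u_k v_k has sign
      0.\<close>
    obtain \<theta> where "sgn (v $ k * u $ k + u $ k * v $ k) = sgn (\<theta> * (v $ k * u $ k - u $ k * v $ k))"
      using phases by blast
    then show ?thesis
      by (simp add: mult.commute sgn_0_0)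
  qed
  have "u = 0 \<or> v = 0"
  proof (rule ccontr)
    assume "\<not> (u = 0 \<or> v = 0)"
    then obtain i j where "u $ i \<noteq> 0" "v $ j \<noteq> 0"
      by (auto simp: vec_eq_iff)
    moreover from this have "v $ i = 0" "u $ j = 0"
      using disjoint by blast+
    \<comment> \<open>One \<theta> serves all coordinates: at i, where v vanishes, it must be 1; at
      j, where u vanishes, it must be -1. The factors 1 let the fact match \<open>phases\<close>
      with s = t = 1.\<close>
    moreover obtain \<theta> where "\<theta> = 1 \<or> \<theta> = -1"
      "\<And>k. sgn (1 * u $ k + 1 * v $ k) = sgn (\<theta> * (1 * u $ k - 1 * v $ k))"
      using phases by blast
    from this(1) this(2)[of i] this(2)[of j] calculation show False
      by (auto simp: sgn_if split: if_splits)
  qed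
  \<comment> \<open>v = 0 gives the first case, u = 0 the second; the scalars are spelled out as
    witnesses for \<theta>.\<close>
  then have "x = 1 *\<^sub>R y \<or> x = (-1) *\<^sub>R y"
    by (auto simp: u_def v_def eq_neg_iff_add_eq_0)
  then show "\<exists>\<theta>\<in>{1, -1}. x = \<theta> *\<^sub>R y"
    by blast
qed

theorem corollary2p8:
  fixes n :: nat and P :: "nat \<Rightarrow> real ^ 'm \<Rightarrow> real ^ 'm"
  assumes "\<And>i. i \<in> {1..n} \<Longrightarrow> orthogonal_projection (P i)"
  shows "does_phase_retrieval n P \<longleftrightarrow> does_phaseless_reconstruction n P"
proof
  assume "does_phase_retrieval n P"
  with assms show "does_phaseless_reconstruction n P"
    by (intro phase_retrieval_imp_phaseless_reconstruction) (simp_all add: orthogonal_projection_def)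
next
  assume "does_phaseless_reconstruction n P"
  then show "does_phase_retrieval n P"
    unfolding does_phaseless_reconstruction_def does_phase_retrieval_def
    \<comment> \<open>The \<theta> with x = \<theta> y serves again, as x has the same phases as
      itself.\<close>
    by (metis same_phases_refl)
qed

end
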